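(* Let $0<a<1$ and $0\le b<1$, and suppose that the multi-valued map $f_\pm$ has a periodic orbit $C$. Then $f_\pm$ is asymptotically periodic and $C$ is the universal limit cycle for $f_\pm$.
   Context: For real $x$ let $\{x\}:=x-\lfloor x\rfloor\in[0,1)$ and $\{x\}_+:=1-\{-x\}\in(0,1]$. For constants $0<a<1$, $0\le b<1$ define $f_-,f_+:[0,1]\to[0,1]$ by $f_-(x)=\{ax+b\}$, $f_+(x)=\{ax+b\}_+$, and let $f_\pm$ be the multi-valued map $x\mapsto\{f_-(x),f_+(x)\}$ (a single value unless $ax+b$ is an integer, in which case the two values are $0$ and $1$). An orbit of $x\in[0,1]$ under $f_\pm$ is any sequence $(x_n)_{n\ge0}$ with $x_0=x$ and $x_{n+1}\in f_\pm(x_n)$ for all $n\ge0$. A periodic orbit is an orbit with $x_{n+q}=x_n$ for some $q\ge1$ and all $n\ge0$; it is then written $\{x_0,\dots,x_{q-1}\}$. An orbit $(x_n)$ converges to a periodic orbit $C=\{y_0,\dots,y_{k-1}\}$ if there exists $j$ such that $x_n-y_{(j+n)\bmod k}\to0$ as $n\to\infty$. $C$ is a limit cycle of $x$ if every orbit starting at $x$ converges to $C$; $C$ is a universal limit cycle if it is a limit cycle of every $x\in[0,1]$. The $\omega$-limit set $\omega_{f_\pm}(x)$ is the set of all $p$ such that there exist an orbit $(x_n)_{n\ge 0}$ of $x$ under $f_\pm$ and a strictly increasing sequence of positive integers $n_\ell$ with $x_{n_\ell}\to p$. $f_\pm$ is asymptotically periodic if $\omega_{f_\pm}(x)$ is (the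 set of points of) a periodic orbit of $f_\pm$ for every $x\in[0,1]$. *)

theory Defs
  imports Complex_Main
begin

definition frac_plus :: "real \<Rightarrow> real" where
  "frac_plus x = 1 - frac (- x)"

(* The maps are total on the reals; only their values on {0..1} matter, since
   orbits start in {0..1} and both maps take values in {0..1}. *)

definition f_minus :: "real \<Rightarrow> real \<Rightarrow> real \<Rightarrow> real" where
  "f_minus a b x = frac (a * x + b)"

definition f_plus :: "real \<Rightarrow> real \<Rightarrow> real \<Rightarrow> real" where
  "f_plus a b x = frac_plus (a * x + b)"

definition f_pm :: "real \<Rightarrow> real \<Rightarrow> real \<Rightarrow> real set" where
  "f_pm a b x = {f_minus a b x, f_plus a b x}"

definition is_orbit :: "(real \<Rightarrow> real set) \<Rightarrow> real \<Rightarrow> (nat \<Rightarrow> real) \<Rightarrow> bool" where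
  "is_orbit F x s \<longleftrightarrow> x \<in> {0..1} \<and> s 0 = x \<and> (\<forall>n. s (Suc n) \<in> F (s n))"

(* A periodic orbit {y 0, ..., y (k - 1)} is represented by the whole sequence y together
   with a (not necessarily minimal) period k; its set of points is cycle_points y k. *)

definition periodic_orbit :: "(real \<Rightarrow> real set) \<Rightarrow> (nat \<Rightarrow> real) \<Rightarrow> nat \<Rightarrow> bool" where
  "periodic_orbit F y k \<longleftrightarrow> k \<ge> 1 \<and> is_orbit F (y 0) y \<and> (\<forall>n. y (n + k) = y n)"

definition cycle_points :: "(nat \<Rightarrow> real) \<Rightarrow> nat \<Rightarrow> real set" where
  "cycle_points y k = y ` {..<k}"

definition converges_to_cycle :: "(nat \<Rightarrow> real) \<Rightarrow> (nat \<Rightarrow> real) \<Rightarrow> nat \<Rightarrow> bool" where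
  "converges_to_cycle s y k \<longleftrightarrow> (\<exists>j. (\<lambda>n. s n - y ((j + n) mod k)) \<longlonglongrightarrow> 0)"

definition limit_cycle :: "(real \<Rightarrow> real set) \<Rightarrow> (nat \<Rightarrow> real) \<Rightarrow> nat \<Rightarrow> real \<Rightarrow> bool" where
  "limit_cycle F y k x \<longleftrightarrow>
     periodic_orbit F y k \<and> (\<forall>s. is_orbit F x s \<longrightarrow> converges_to_cycle s y k)"

definition universal_limit_cycle :: "(real \<Rightarrow> real set) \<Rightarrow> (nat \<Rightarrow> real) \<Rightarrow> nat \<Rightarrow> bool" where
  "universal_limit_cycle F y k \<longleftrightarrow> (\<forall>x\<in>{0..1}. limit_cycle F y k x)"

definition omega_limit :: "(real \<Rightarrow> real set) \<Rightarrow> real \<Rightarrow> real set" where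
  "omega_limit F x =
     {p. \<exists>s r. is_orbit F x s \<and> strict_mono (r :: nat \<Rightarrow> nat) \<and> (\<forall>l. r l > 0) \<and>
            (\<lambda>l. s (r l)) \<longlonglongrightarrow> p}"

definition asymptotically_periodic :: "(real \<Rightarrow> real set) \<Rightarrow> bool" where
  "asymptotically_periodic F \<longleftrightarrow>
     (\<forall>x\<in>{0..1}. \<exists>y k. periodic_orbit F y k \<and> omega_limit F x = cycle_points y k)"

end

(* Write x_{n+1} = a x_n + b - (m_{n+1} - m_n) with integers m_n, the code of the orbit.  The lift
   X_n = x_n + m_n satisfies X_{n+1} = a X_n + b + (1 - a) m_n, and strict order between two lifts
   persists and forces weak order between their codes; if the lifts agree for ever, so do the codes.
   So any two codes are eventually comparable.  Since C has a code with m_{n+k} = m_n + p, comparing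
   a code with its own shift by k shows that every code eventually satisfies this equation.  Two
   comparable codes of this kind agree as soon as their sums over a period do, and by Bezout the
   sums can be made equal by shifting.  Orbits with the same code approach each other like a^n. *)

theory Submission
  imports Defs
begin

section \<open>Integer sequences that are eventually comparable\<close>

definition eventually_comparable :: "(nat \<Rightarrow> int) \<Rightarrow> (nat \<Rightarrow> int) \<Rightarrow> bool" where
  "eventually_comparable f g \<longleftrightarrow>
     (\<exists>N. \<forall>n\<ge>N. f n \<le> g n) \<or> (\<exists>N. \<forall>n\<ge>N. g n \<le> f n)"

lemma bounded_int_mono_eventually_const:
  fixes f :: "nat \<Rightarrow> int"
  assumes mono: "\<And>n. n \<ge> N \<Longrightarrow> f n \<le> f (Suc n)" and bound: "\<And>n. f n \<le> B"
  shows "\<exists>N'. \<forall>n\<ge>N'. f (Suc n) = f n"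
proof -
  have le: "f m \<le> f n" if "N \<le> m" "m \<le> n" for m n
    using that(2)
  proof (induction n rule: dec_induct)
    case (step n)
    then show ?case using mono[of n] \<open>N \<le> m\<close> by simp
  qed simp
  have "f ` {N..} \<subseteq> {f N..B}"
    using le bound by auto
  then have fin: "finite (f ` {N..})"
    by (rule finite_subset) simp
  then have "Max (f ` {N..}) \<in> f ` {N..}"
    by (intro Max_in) auto
  then obtain N' where N': "N' \<ge> N" "f N' = Max (f ` {N..})" by auto
  have "f n = f N'" if "n \<ge> N'" for n
  proof (rule antisym)
    show "f n \<le> f N'" using fin N' that by (auto intro!: Max_ge)
    show "f N' \<le> f n" using N'(1) that by (rule le)
  qed
  then have "f (Suc n) = f n" if "n \<ge> N'" for n
    using that le_SucI by metis
  then show ?thesis by blast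
qed

lemma window_sum_Suc:
  fixes f :: "nat \<Rightarrow> int"
  shows "(\<Sum>r<k. f (Suc n + r)) = (\<Sum>r<k. f (n + r)) + (f (n + k) - f n)"
proof -
  have "(\<Sum>r<k. f (Suc n + r)) - (\<Sum>r<k. f (n + r)) = (\<Sum>r<k. f (n + Suc r) - f (n + r))"
    by (simp add: sum_subtractf)
  also have "\<dots> = f (n + k) - f n"
    using sum_lessThan_telescope[of "\<lambda>r. f (n + r)" k] by simp
  finally show ?thesis by simp
qed

text \<open>The defect \<open>f (n + k) - f n - p\<close> is the increment of a drift-corrected
  window sum of \<open>f\<close>, and comparability gives it a constant sign from some time on.
  Closeness to \<open>g\<close>, whose corrected sum is constant, bounds that sum, so an integer
  sequence that is monotone from there on must become constant.\<close>

lemma eventually_quasiperiodic: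
  fixes f g :: "nat \<Rightarrow> int"
  assumes g: "\<And>n. g (n + k) = g n + p"
    and bound: "\<And>n. f n \<le> g n + B" "\<And>n. g n \<le> f n + B"
    and comp: "eventually_comparable f (\<lambda>n. f (n + k) - p)"
  shows "\<exists>N. \<forall>n\<ge>N. f (n + k) = f n + p"
proof -
  \<comment> \<open>Subtracting \<open>int n * p\<close> removes the average growth
    \<open>p / k\<close> per step, summed over \<open>k\<close> terms.\<close>
  define S where "S n = (\<Sum>r<k. f (n + r)) - int n * p" for n
  define T where "T n = (\<Sum>r<k. g (n + r)) - int n * p" for n
  have SucS: "S (Suc n) = S n + (f (n + k) - f n - p)" for n
    using window_sum_Suc[where f = f and k = k and n = n] by (simp add: S_def algebra_simps)
  have "T (Suc n) = T n" for n
    using window_sum_Suc[where f = g and k = k and n = n] g[of n]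
    by (simp add: T_def algebra_simps)
  then have T: "T n = T 0" for n by (induction n) auto
  have "(\<Sum>r<k. f (n + r)) \<le> (\<Sum>r<k. g (n + r) + B)"
       "(\<Sum>r<k. g (n + r)) \<le> (\<Sum>r<k. f (n + r) + B)" for n
    by (intro sum_mono bound)+
  then have "S n \<le> T n + int k * B" "T n \<le> S n + int k * B" for n
    by (auto simp: S_def T_def sum.distrib)
  then have S_bound: "S n \<le> T 0 + int k * B" "- S n \<le> int k * B - T 0" for n
    using T[of n] by (smt (verit))+
  from comp consider N where "\<forall>n\<ge>N. f n \<le> f (n + k) - p" | N where "\<forall>n\<ge>N. f (n + k) - p \<le> f n"
    unfolding eventually_comparable_def by blast
  then have "\<exists>N. \<forall>n\<ge>N. S (Suc n) = S n"
  proof cases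
    case (1 N)
    then have "S n \<le> S (Suc n)" if "n \<ge> N" for n
      using SucS[of n] that by force
    then show ?thesis
      by (rule bounded_int_mono_eventually_const[OF _ S_bound(1)])
  next
    case (2 N)
    then have "- S n \<le> - S (Suc n)" if "n \<ge> N" for n
      using SucS[of n] that by force
    then have "\<exists>N'. \<forall>n\<ge>N'. - S (Suc n) = - S n"
      by (rule bounded_int_mono_eventually_const[OF _ S_bound(2)])
    then show ?thesis by simp
  qed
  then show ?thesis using SucS by (smt (verit))
qed

lemma quasiperiodic_iterate:
  fixes f :: "nat \<Rightarrow> int"
  assumes "\<And>n. f (n + k) = f n + p"
  shows "f (n + N * k) = f n + int N * p"
proof (induction N)
  case (Suc N)
  then show ?case using assms[of "n + N * k"] by (simp add: algebra_simps)
qed auto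

lemma quasiperiodic_window_sum:
  fixes f :: "nat \<Rightarrow> int"
  assumes "\<And>n. f (n + k) = f n + p"
  shows "(\<Sum>r<k. f (n + r)) = (\<Sum>r<k. f r) + int n * p"
proof (induction n)
  case (Suc n)
  then show ?case
    using window_sum_Suc[where f = f and k = k and n = n] assms[of n]
    by (simp add: algebra_simps)
qed auto

text \<open>Equal sums over one period stay equal over every window of length \<open>k\<close>. Once
  one sequence dominates the other, equal window sums force termwise equality, and quasiperiodicity
  carries this back to early times.\<close>

lemma quasiperiodic_eqI:
  fixes f g :: "nat \<Rightarrow> int"
  assumes k: "k \<ge> 1"
    and f: "\<And>n. f (n + k) = f n + p" and g: "\<And>n. g (n + k) = g n + p"
    and comp: "eventually_comparable f g"
    and sums: "(\<Sum>r<k. f r) = (\<Sum>r<k. g r)"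
  shows "f n = g n"
proof -
  have S: "(\<Sum>r<k. f (n + r)) = (\<Sum>r<k. g (n + r))" for n
    by (simp add: quasiperiodic_window_sum[of f, OF f] quasiperiodic_window_sum[of g, OF g] sums)
  from comp consider N where "\<forall>n\<ge>N. f n \<le> g n" | N where "\<forall>n\<ge>N. g n \<le> f n"
    unfolding eventually_comparable_def by blast
  then obtain N where N: "\<And>n. n \<ge> N \<Longrightarrow> f n = g n"
  proof cases
    case (1 N)
    \<comment> \<open>Position 0 of the window starting at \<open>n\<close> suffices; it exists
      because \<open>k\<close> is positive.\<close>
    have "f n = g n" if "n \<ge> N" for n
      using sum_mono_inv[OF S[of n], of 0] 1 that k by simp
    then show ?thesis using that by blast
  next
    case (2 N)
    have "g n = f n" if "n \<ge> N" for n
      using sum_mono_inv[OF S[of n, symmetric], of 0] 2 that k by simp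
    then show ?thesis using that by metis
  qed
  have "N \<le> n + N * k" using k by (simp add: trans_le_add2)
  then have "f (n + N * k) = g (n + N * k)" by (rule N)
  then show ?thesis
    using quasiperiodic_iterate[of f, OF f, of n N] quasiperiodic_iterate[of g, OF g, of n N] by simp
qed

text \<open>Shifting by \<open>k'\<close> raises the sum over the long period \<open>d * k'\<close>
  by \<open>k' * (d * p')\<close>, which is exactly what lowering each of the \<open>d * k'\<close>
  terms by \<open>p'\<close> takes away. So \<open>f\<close> and its lowered shift fall under
  \<open>quasiperiodic_eqI\<close>.\<close>

lemma quasiperiodic_reduce:
  fixes f :: "nat \<Rightarrow> int"
  assumes "k' \<ge> 1" "d \<ge> 1"
    and f: "\<And>n. f (n + d * k') = f n + int d * p'"
    and comp: "\<And>j i. eventually_comparable f (\<lambda>n. f (n + j) + i)"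
  shows "f (n + k') = f n + p'"
proof -
  have "(\<Sum>r<d * k'. f (k' + r)) = (\<Sum>r<d * k'. f r) + int k' * (int d * p')"
    by (rule quasiperiodic_window_sum[of f, OF f])
  then have "(\<Sum>r<d * k'. f r) = (\<Sum>r<d * k'. f (r + k') + - p')"
    by (simp add: sum_subtractf add.commute)
  moreover have "f (n + d * k' + k') = f (n + k') + int d * p'" for n
    using f[of "n + k'"] by (simp add: ac_simps)
  ultimately have "f n = f (n + k') + - p'"
    using \<open>k' \<ge> 1\<close> \<open>d \<ge> 1\<close> comp[of k' "- p'"]
    by (intro quasiperiodic_eqI[of "d * k'" f "int d * p'", OF _ f]) simp_all
  then show ?thesis by simp
qed

text \<open>After dividing period and increment by their gcd, a shift by \<open>j\<close> and a
  translation by \<open>i\<close> change the sum over a period by \<open>j * p' + k' * i\<close>. As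
  \<open>k'\<close> and \<open>p'\<close> are coprime, this can be any integer, in particular the
  difference of the two sums.\<close>

lemma quasiperiodic_shift_eq:
  fixes f g :: "nat \<Rightarrow> int"
  assumes k: "k \<ge> 1"
    and f: "\<And>n. f (n + k) = f n + p" and g: "\<And>n. g (n + k) = g n + p"
    and ff: "\<And>j i. eventually_comparable f (\<lambda>n. f (n + j) + i)"
    and gg: "\<And>j i. eventually_comparable g (\<lambda>n. g (n + j) + i)"
    and fg: "\<And>j i. eventually_comparable f (\<lambda>n. g (n + j) + i)"
  shows "\<exists>j i. \<forall>n. f n = g (n + j) + i"
proof -
  define d where "d = nat (gcd (int k) p)"
  have d: "d \<ge> 1" "int d = gcd (int k) p"
    using k by (auto simp: d_def Suc_le_eq)
  have "int d dvd int k" "int d dvd p"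
    using d(2) by auto
  then have "d dvd k"
    by presburger
  obtain k' where k': "k = d * k'"
    using \<open>d dvd k\<close> by blast
  obtain p' where p': "p = int d * p'"
    using \<open>int d dvd p\<close> by blast
  have "k' \<ge> 1"
    using k k' by (cases k') auto
  have "int d * gcd (int k') p' = int d * 1"
    using gcd_mult_distrib_int[of "int d" "int k'" p'] d unfolding k' p' by simp
  then have "gcd (int k') p' = 1"
    using d(1) by simp
  then obtain u v where uv: "u * int k' + v * p' = 1"
    using bezout_int[of "int k'" p'] by auto
  have f': "f (n + k') = f n + p'" for n
    using quasiperiodic_reduce[OF \<open>k' \<ge> 1\<close> \<open>d \<ge> 1\<close>, of f p'] f ff by (simp add: k' p')
  have g': "g (n + k') = g n + p'" for n
    using quasiperiodic_reduce[OF \<open>k' \<ge> 1\<close> \<open>d \<ge> 1\<close>, of g p'] g gg by (simp add: k' p')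
  define \<Delta> where "\<Delta> = (\<Sum>r<k'. f r) - (\<Sum>r<k'. g r)"
  \<comment> \<open>The Bezout solution \<open>v * \<Delta>\<close> may be negative, but a shift
    must be a natural number; so the remainder mod \<open>k'\<close> is taken and \<open>i\<close>
    absorbs the quotient.\<close>
  define j where "j = nat ((v * \<Delta>) mod int k')"
  define q where "q = (v * \<Delta>) div int k'"
  define i where "i = u * \<Delta> + q * p'"
  have j: "int j = v * \<Delta> - int k' * q"
    using \<open>k' \<ge> 1\<close> by (simp add: j_def q_def minus_mult_div_eq_mod)
  have "int j * p' + int k' * i = \<Delta> * (u * int k' + v * p')"
    unfolding j i_def by (simp add: algebra_simps)
  then have ji: "int j * p' + int k' * i = \<Delta>" by (simp add: uv)
  have "(\<Sum>r<k'. g (j + r)) = (\<Sum>r<k'. g r) + int j * p'"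
    by (rule quasiperiodic_window_sum[of g, OF g'])
  then have "(\<Sum>r<k'. f r) = (\<Sum>r<k'. g (r + j) + i)"
    using ji by (simp add: sum.distrib \<Delta>_def add.commute)
  moreover have "g (n + k' + j) = g (n + j) + p'" for n
    using g'[of "n + j"] by (simp add: ac_simps)
  ultimately have "f n = g (n + j) + i" for n
    using \<open>k' \<ge> 1\<close> f' fg
    by (intro quasiperiodic_eqI[of k' f p' "\<lambda>n. g (n + j) + i"]) auto
  then show ?thesis by blast
qed

section \<open>Codes of orbits\<close>

text \<open>Both branches are representatives modulo 1, and the closed interval contains two of them
  only at integers. This form removes the case split between the branches.\<close>

lemma f_pm_iff: "z \<in> f_pm a b x \<longleftrightarrow> z \<in> {0..1} \<and> a * x + b - z \<in> \<int>"
proof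
  assume "z \<in> f_pm a b x"
  then consider "z = frac (a * x + b)" | "z = 1 - frac (- (a * x + b))"
    by (auto simp: f_pm_def f_minus_def f_plus_def frac_plus_def)
  then show "z \<in> {0..1} \<and> a * x + b - z \<in> \<int>"
  proof cases
    case 1
    then show ?thesis
      using frac_ge_0[of "a * x + b"] frac_lt_1[of "a * x + b"] by (auto simp: frac_def)
  next
    case 2
    have "a * x + b - z = - 1 - of_int \<lfloor>- (a * x + b)\<rfloor>"
      using 2 by (simp add: frac_def)
    then have "a * x + b - z \<in> \<int>"
      by (metis Ints_1 Ints_diff Ints_minus Ints_of_int)
    moreover have "z \<in> {0..1}"
      using 2 frac_ge_0[of "- (a * x + b)"] frac_lt_1[of "- (a * x + b)"] by auto
    ultimately show ?thesis by blast
  qed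
next
  assume z: "z \<in> {0..1} \<and> a * x + b - z \<in> \<int>"
  show "z \<in> f_pm a b x"
  proof (cases "z = 1")
    case True
    then have "a * x + b \<in> \<int>"
      using z Ints_add[of "a * x + b - z" 1] by simp
    then have "frac (- (a * x + b)) = 0"
      by (metis frac_eq_0_iff Ints_minus)
    then show ?thesis
      using True by (simp add: f_pm_def f_plus_def frac_plus_def)
  next
    case False
    then have "frac (a * x + b) = z"
      using z by (auto simp: frac_unique_iff)
    then show ?thesis by (simp add: f_pm_def f_minus_def)
  qed
qed

text \<open>Only increments of \<open>m\<close> enter, so an orbit fixes its code up to an additive
  constant.\<close>

definition has_code :: "real \<Rightarrow> real \<Rightarrow> (nat \<Rightarrow> real) \<Rightarrow> (nat \<Rightarrow> int) \<Rightarrow> bool" where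
  "has_code a b s m \<longleftrightarrow>
     (\<forall>n. s n \<in> {0..1} \<and> s (Suc n) = a * s n + b - of_int (m (Suc n) - m n))"

lemma has_code_shift:
  "has_code a b s m \<Longrightarrow> has_code a b (\<lambda>n. s (n + j)) (\<lambda>n. m (n + j) + i)"
  by (simp add: has_code_def)

lemma orbit_has_code:
  assumes "is_orbit (f_pm a b) x s"
  shows "\<exists>m. has_code a b s m"
proof -
  have "s n \<in> {0..1}" for n
    using assms by (cases n) (auto simp: is_orbit_def f_pm_iff)
  moreover have "\<exists>d. a * s n + b - s (Suc n) = of_int d" for n
    using assms by (auto simp: is_orbit_def f_pm_iff elim!: Ints_cases)
  then obtain d where "\<And>n. a * s n + b - s (Suc n) = of_int (d n)"
    by metis
  then have "s (Suc n) = a * s n + b - of_int ((\<Sum>r<Suc n. d r) - (\<Sum>r<n. d r))" for n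
    by (simp add: algebra_simps)
  ultimately have "has_code a b s (\<lambda>n. \<Sum>r<n. d r)"
    by (simp only: has_code_def) blast
  then show ?thesis by blast
qed

lemma has_code_lift:
  assumes "has_code a b s m"
  shows "s (Suc n) + of_int (m (Suc n)) = a * (s n + of_int (m n)) + b + (1 - a) * of_int (m n)"
  using assms by (simp add: has_code_def algebra_simps)

text \<open>Strictness matters: equal lifts with \<open>s n = 0\<close> and \<open>t n = 1\<close>
  would have \<open>m n = l n + 1\<close>.\<close>

lemma lift_less_code_le:
  assumes "has_code a b s m" "has_code a b t l"
    and "s n + of_int (m n) < t n + of_int (l n)"
  shows "m n \<le> l n"
proof -
  have "0 \<le> s n" "t n \<le> 1"
    using assms(1,2) by (auto simp: has_code_def)
  then have "real_of_int (m n) < of_int (l n) + 1"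
    using assms(3) by linarith
  then show ?thesis by linarith
qed

lemma lift_less_persists:
  assumes "0 < a" "a < 1" and st: "has_code a b s m" "has_code a b t l"
    and less: "s N + of_int (m N) < t N + of_int (l N)" and "n \<ge> N"
  shows "s n + of_int (m n) < t n + of_int (l n)"
  using \<open>n \<ge> N\<close>
proof (induction n rule: dec_induct)
  case base
  show ?case by (fact less)
next
  case (step n)
  have "(1 - a) * of_int (m n) \<le> (1 - a) * of_int (l n)"
    using lift_less_code_le[OF st step.IH] \<open>a < 1\<close> by (simp add: mult_left_mono)
  moreover have "a * (s n + of_int (m n)) < a * (t n + of_int (l n))"
    using step.IH \<open>0 < a\<close> by (rule mult_strict_left_mono)
  ultimately show ?case
    unfolding has_code_lift[OF st(1)] has_code_lift[OF st(2)] by linarith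
qed

lemma codes_eventually_comparable:
  assumes "0 < a" "a < 1" and st: "has_code a b s m" "has_code a b t l"
  shows "eventually_comparable m l"
proof -
  consider N where "s N + of_int (m N) < t N + of_int (l N)"
    | N where "t N + of_int (l N) < s N + of_int (m N)"
    | "\<And>n. s n + of_int (m n) = t n + of_int (l n)"
    by (meson linorder_cases)
  then show ?thesis
  proof cases
    case 1
    then show ?thesis
      using lift_less_code_le[OF st lift_less_persists[OF assms]]
      unfolding eventually_comparable_def by blast
  next
    case 2
    then show ?thesis
      using lift_less_code_le[OF st(2,1) lift_less_persists[OF assms(1,2) st(2,1)]]
      unfolding eventually_comparable_def by blast
  next
    case 3
    \<comment> \<open>With equal lifts at \<open>n\<close> and \<open>Suc n\<close>, the recursion
      leaves only \<open>(1 - a) * m n = (1 - a) * l n\<close>.\<close>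
    have "m n = l n" for n
      using has_code_lift[OF st(1), of n] has_code_lift[OF st(2), of n] 3[of n] 3[of "Suc n"]
        \<open>a < 1\<close> by auto
    then show ?thesis by (simp add: eventually_comparable_def)
  qed
qed

text \<open>Raising \<open>l\<close> by \<open>B\<close> puts its lift strictly above at time 0, and
  the order persists. The 2 covers the unit length of the interval and makes the inequality
  strict.\<close>

lemma code_le_code_plus_const:
  assumes "0 < a" "a < 1" and st: "has_code a b s m" "has_code a b t l"
    and B: "B \<ge> m 0 - l 0 + 2"
  shows "m n \<le> l n + B"
proof -
  have t: "has_code a b t (\<lambda>n. l n + B)"
    using has_code_shift[OF st(2), of 0 B] by simp
  have "s 0 \<le> 1" "0 \<le> t 0"
    using st by (auto simp: has_code_def)
  then have "s 0 + of_int (m 0) < t 0 + of_int (l 0 + B)"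
    using B by linarith
  then show ?thesis
    using lift_less_code_le[OF st(1) t lift_less_persists[OF assms(1,2) st(1) t, of 0]] by simp
qed

lemma same_code_tendsto:
  assumes "0 < a" "a < 1" "has_code a b s m" "has_code a b t m"
  shows "(\<lambda>n. s n - t n) \<longlonglongrightarrow> 0"
proof -
  have "s n - t n = a ^ n * (s 0 - t 0)" for n
  proof (induction n)
    case (Suc n)
    have "s (Suc n) - t (Suc n) = a * (s n - t n)"
      using assms(3,4) by (simp add: has_code_def right_diff_distrib)
    then show ?case by (simp add: Suc)
  qed simp
  then have eq: "(\<lambda>n. s n - t n) = (\<lambda>n. a ^ n * (s 0 - t 0))"
    by (rule ext)
  show ?thesis
    unfolding eq using assms(1,2) by (intro tendsto_mult_left_zero LIMSEQ_realpow_zero) auto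
qed

text \<open>Consecutive orbit points determine the code increment between them, so the increments
  are \<open>k\<close>-periodic.\<close>

lemma periodic_code_quasiperiodic:
  assumes "has_code a b y l" and per: "\<And>n. y (n + k) = y n"
  shows "l (n + k) = l n + (l k - l 0)"
proof (induction n)
  case (Suc n)
  have "y (Suc n + k) = y (Suc n)" by (rule per)
  then have "real_of_int (l (Suc n + k) - l (n + k)) = of_int (l (Suc n) - l n)"
    using assms(1) per[of n] by (simp add: has_code_def)
  then show ?case using Suc by linarith
qed simp

section \<open>Convergence to the cycle\<close>

lemma periodic_mod:
  fixes y :: "nat \<Rightarrow> 'a"
  assumes "\<And>n. y (n + k) = y n"
  shows "y (n mod k) = y n"
proof -
  have "y (n + q * k) = y n" for n q
  proof (induction q)
    case (Suc q)
    then show ?case using assms[of "n + q * k"] by (simp add: algebra_simps)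
  qed simp
  from this[of "n mod k" "n div k"] show ?thesis by simp
qed

lemma orbit_converges_to_cycle:
  assumes a: "0 < a" "a < 1" and y: "periodic_orbit (f_pm a b) y k"
    and s: "is_orbit (f_pm a b) x s"
  shows "converges_to_cycle s y k"
proof -
  have k: "k \<ge> 1" and per: "\<And>n. y (n + k) = y n"
    using y by (auto simp: periodic_orbit_def)
  obtain m where m: "has_code a b s m"
    using orbit_has_code[OF s] by blast
  obtain l where l: "has_code a b y l"
    using orbit_has_code y unfolding periodic_orbit_def by blast
  define p where "p = l k - l 0"
  have l_per: "l (n + k) = l n + p" for n
    unfolding p_def by (rule periodic_code_quasiperiodic[OF l per])
  have "eventually_comparable m (\<lambda>n. m (n + k) - p)"
    using codes_eventually_comparable[OF a m has_code_shift[OF m, of k "- p"]] by simp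
  \<comment> \<open>The absolute value makes one constant serve for both directions of the
    bound.\<close>
  then obtain N where N: "\<And>n. n \<ge> N \<Longrightarrow> m (n + k) = m n + p"
    using eventually_quasiperiodic[of l k p m "\<bar>m 0 - l 0\<bar> + 2", OF l_per]
      code_le_code_plus_const[OF a m l] code_le_code_plus_const[OF a l m] by fastforce
  define s' where "s' n = s (n + N)" for n
  define m' where "m' n = m (n + N)" for n
  have m': "has_code a b s' m'"
    using has_code_shift[OF m, of N 0] by (simp add: s'_def[abs_def] m'_def[abs_def])
  have "m' (n + k) = m' n + p" for n
    using N[of "n + N"] by (simp add: m'_def ac_simps)
  then obtain j i where ji: "\<And>n. m' n = l (n + j) + i"
    using quasiperiodic_shift_eq[OF k _ l_per
        codes_eventually_comparable[OF a m' has_code_shift[OF m']]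
        codes_eventually_comparable[OF a l has_code_shift[OF l]]
        codes_eventually_comparable[OF a m' has_code_shift[OF l]]] by blast
  have "has_code a b (\<lambda>n. y (n + j)) m'"
    using has_code_shift[OF l, of j i] by (simp add: ji[abs_def])
  then have "(\<lambda>n. s' n - y (n + j)) \<longlonglongrightarrow> 0"
    by (rule same_code_tendsto[OF a m'])
  \<comment> \<open>The index \<open>n + j\<close> belongs to time \<open>n + N\<close>; the offset \<open>j - N\<close> is made nonnegative mod \<open>k\<close>.\<close>
  moreover have "y ((j + (k - 1) * N + (n + N)) mod k) = y (n + j)" for n
  proof -
    have "j + (k - 1) * N + (n + N) = n + j + k * N"
      using k by (cases k) auto
    then show ?thesis
      by (metis mod_mult_self2 periodic_mod[of y k, OF per])
  qed
  ultimately have "(\<lambda>n. s (n + N) - y ((j + (k - 1) * N + (n + N)) mod k)) \<longlonglongrightarrow> 0"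
    by (simp add: s'_def)
  then have "(\<lambda>n. s n - y ((j + (k - 1) * N + n) mod k)) \<longlonglongrightarrow> 0"
    by (rule LIMSEQ_offset)
  then show ?thesis
    unfolding converges_to_cycle_def by blast
qed

lemma orbit_exists:
  assumes "x \<in> {0..1}"
  shows "\<exists>s. is_orbit (f_pm a b) x s"
  using assms by (intro exI[of _ "\<lambda>n. (f_minus a b ^^ n) x"]) (simp add: is_orbit_def f_pm_def)

text \<open>Limit points stay in the cycle because a finite set is closed. Conversely, a single
  orbit reaches each cycle point in the limit along times in one residue class mod
  \<open>k\<close>.\<close>

lemma omega_limit_eq_cycle_points:
  assumes lim: "limit_cycle F y k x" and "is_orbit F x s"
  shows "omega_limit F x = cycle_points y k"
proof (intro equalityI subsetI)
  have k: "k \<ge> 1"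
    using lim by (auto simp: limit_cycle_def periodic_orbit_def)
  {
    fix p assume "p \<in> omega_limit F x"
    then obtain t r where t: "is_orbit F x t" and r: "strict_mono (r :: nat \<Rightarrow> nat)"
      and p: "(\<lambda>l. t (r l)) \<longlonglongrightarrow> p"
      by (auto simp: omega_limit_def)
    obtain j where j: "(\<lambda>n. t n - y ((j + n) mod k)) \<longlonglongrightarrow> 0"
      using lim t by (auto simp: limit_cycle_def converges_to_cycle_def)
    have "(\<lambda>l. t (r l) - y ((j + r l) mod k)) \<longlonglongrightarrow> 0"
      using LIMSEQ_subseq_LIMSEQ[OF j r] by (simp add: o_def)
    from tendsto_diff[OF p this] have "(\<lambda>l. y ((j + r l) mod k)) \<longlonglongrightarrow> p"
      by simp
    moreover have "closed (cycle_points y k)"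
      by (simp add: cycle_points_def finite_imp_closed)
    moreover have "y ((j + r l) mod k) \<in> cycle_points y k" for l
      using k by (simp add: cycle_points_def)
    ultimately show "p \<in> cycle_points y k"
      by (meson closed_sequentially)
  next
    fix p assume "p \<in> cycle_points y k"
    then obtain i where i: "i < k" "p = y i"
      by (auto simp: cycle_points_def)
    obtain j where j: "(\<lambda>n. s n - y ((j + n) mod k)) \<longlonglongrightarrow> 0"
      using lim assms(2) by (auto simp: limit_cycle_def converges_to_cycle_def)
    \<comment> \<open>\<open>(k - 1) * j\<close> stands for \<open>- j\<close> modulo \<open>k\<close>.\<close>
    define r where "r l = (k - 1) * j + i + k * Suc l" for l
    have r: "strict_mono r" "\<And>l. r l > 0"
      using k by (auto simp: r_def strict_mono_Suc_iff)
    have "j + r l = i + k * (j + Suc l)" for l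
      using k by (cases k) (auto simp: r_def algebra_simps)
    then have "(j + r l) mod k = i" for l
      using i by (metis mod_less mod_mult_self2)
    then have "(\<lambda>l. s (r l) - p) \<longlonglongrightarrow> 0"
      using LIMSEQ_subseq_LIMSEQ[OF j r(1)] i by (simp add: o_def)
    then have "(\<lambda>l. s (r l)) \<longlonglongrightarrow> p"
      by (rule LIM_zero_cancel)
    then show "p \<in> omega_limit F x"
      using r assms(2) unfolding omega_limit_def by blast
  }
qed

text \<open>The last conjunct renders the definite article in "the universal limit cycle". It
  compares point sets because the representing sequence and period of a cycle are not
  unique.\<close>

theorem theorem3p3:
  fixes a b :: real and y :: "nat \<Rightarrow> real" and k :: nat
  assumes "0 < a" and "a < 1" and "0 \<le> b" and "b < 1"
    and "periodic_orbit (f_pm a b) y k"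
  shows "asymptotically_periodic (f_pm a b) \<and>
    universal_limit_cycle (f_pm a b) y k \<and>
    (\<forall>z l. universal_limit_cycle (f_pm a b) z l \<longrightarrow> cycle_points z l = cycle_points y k)"
proof -
  have univ: "universal_limit_cycle (f_pm a b) y k"
    using assms orbit_converges_to_cycle
    by (auto simp: universal_limit_cycle_def limit_cycle_def)
  have omega: "omega_limit (f_pm a b) x = cycle_points z l"
    if "universal_limit_cycle (f_pm a b) z l" "x \<in> {0..1}" for z l x
    using that orbit_exists omega_limit_eq_cycle_points
    by (metis universal_limit_cycle_def)
  have "asymptotically_periodic (f_pm a b)"
    using omega[OF univ] assms(5) unfolding asymptotically_periodic_def by blast
  moreover have "cycle_points z l = cycle_points y k"
    if "universal_limit_cycle (f_pm a b) z l" for z l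
    \<comment> \<open>Both point sets equal the omega-limit set of the same starting point, here
      0.\<close>
    using omega[OF that, of 0] omega[OF univ, of 0] by simp
  ultimately show ?thesis
    using univ by blast
qed

end
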